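(* Let $K\subset\mathbb{R}^d$ be a strictly convex polyhedral cone with set of generators $W=\{w_1,\dots,w_n\}$, $n\ge d$. Suppose the generators $w_1,\dots,w_n$ of $K$ are in general positions such that no $d$-element subset of them is linearly dependent; or equivalently, $K$ is the cone over a simplicial polytope of dimension $d-1$. Then the $\binom{n}{d-1}\times\binom{n-1}{d-1}$ matrix $A_K$, whose rows are the vectors $\nu_{n-d}(D^* )$ for $D$ ranging over all $(d-1)$-element subsets of $W$, has full rank.
   Context: $\langle\cdot,\cdot\rangle$ is the standard inner product on $\mathbb{R}^d$. The cone with apex $v$ and generators $w_1,\dots,w_n$ is $K=\{v+t_1w_1+\dots+t_nw_n : t_1,\dots,t_n>0\}$; strictly convex means that $K$ does not contain a line. A simplicial polytope is a convex polytope all of whose proper faces are simplices. Generalized cross product: for $x_1,\dots,x_{d-1}\in\mathbb{R}^d$, $[x_1,\dots,x_{d-1}]\in\mathbb{R}^d$ is the unique vector with $\langle[x_1,\dots,x_{d-1}],x\rangle=\det(x_1,\dots,x_{d-1},x)$ for all $x\in\mathbb{R}^d$. For a $(d-1)$-element subset $D=\{w_{i_1},\dots,w_{i_{d-1}}\}$ of $W$ (a "diagonal" of $K$), with a fixed ordering of its elements, $D^*:=[w_{i_1},\dots,w_{i_{d-1}}]$. Veronese map: $\nu_k:\mathbb{R}^d\to\mathbb{R}^{\binom{d+k-1}{d-1}}$ sends $x$ to the vector of values at $x$ of all monomials $x_1^{e_1}\cdots x_d^{e_d}$ with $e_i\ge0$ integers and $e_1+\dots+e_d=k$ (in a fixed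 order). The matrix $A_K$ is the coefficient matrix of the linear system expressing the values at the points $D^*$ of an unknown homogeneous polynomial of degree $n-d$ in $d$ variables in terms of its coefficients. *)

theory Defs
  imports "Jordan_Normal_Form.DL_Rank"
begin

text \<open>Points of \<open>\<real>\<^sup>d\<close> are the elements of \<^term>\<open>carrier_vec d\<close>.\<close>

definition cone :: "nat \<Rightarrow> real vec \<Rightarrow> real vec set \<Rightarrow> real vec set" where
  "cone d v W =
    {v + module.lincomb (module_vec TYPE(real) d) t W |t. \<forall>w\<in>W. t w > 0}"

definition strictly_convex :: "nat \<Rightarrow> real vec set \<Rightarrow> bool" where
  "strictly_convex d K \<longleftrightarrow>
    \<not> (\<exists>p\<in>carrier_vec d. \<exists>u\<in>carrier_vec d.
        u \<noteq> 0\<^sub>v d \<and> {p + s \<cdot>\<^sub>v u |s. True} \<subseteq> K)"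

definition general_position :: "nat \<Rightarrow> real vec set \<Rightarrow> bool" where
  "general_position d W \<longleftrightarrow>
    (\<forall>S. S \<subseteq> W \<and> card S = d \<longrightarrow> \<not> module.lin_dep class_ring (module_vec TYPE(real) d) S)"

definition cross_product :: "nat \<Rightarrow> real vec list \<Rightarrow> real vec" where
  "cross_product d xs =
    (THE c. c \<in> carrier_vec d \<and>
      (\<forall>x\<in>carrier_vec d. c \<bullet> x = det (mat_of_cols d (xs @ [x]))))"

lemma cross_product_unique_exists:
  assumes d: "d \<ge> 1" and len: "length xs = d - 1"
  shows "\<exists>!c. c \<in> carrier_vec d \<and>
    (\<forall>x\<in>carrier_vec d. c \<bullet> x = det (mat_of_cols d (xs @ [x])))"
proof -
  define c where "c = vec d (\<lambda>i. cofactor (mat_of_cols d (xs @ [0\<^sub>v d])) i (d - 1))"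
  have c: "c \<in> carrier_vec d" by (simp add: c_def)
  have eq: "c \<bullet> x = det (mat_of_cols d (xs @ [x]))" if x: "x \<in> carrier_vec d" for x
  proof -
    let ?A = "mat_of_cols d (xs @ [x])" and ?B = "mat_of_cols d (xs @ [0\<^sub>v d])"
    have A: "?A \<in> carrier_mat d d"
      using d len by (simp add: mat_of_cols_def)
    have del: "mat_delete ?A i (d - 1) = mat_delete ?B i (d - 1)" if "i < d" for i
      using d len that
      by (cases d; intro eq_matI) (auto simp: mat_delete_def mat_of_cols_def nth_append)
    have "det ?A = (\<Sum>i<d. ?A $$ (i, d - 1) * cofactor ?A i (d - 1))"
      using d by (intro laplace_expansion_column[OF A]) simp
    also have "\<dots> = (\<Sum>i<d. x $ i * c $ i)"
      using d len x del
      by (intro sum.cong) (auto simp: c_def cofactor_def mat_of_cols_def nth_append)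
    also have "\<dots> = c \<bullet> x"
      using x by (simp add: scalar_prod_def mult.commute lessThan_atLeast0)
    finally show ?thesis by simp
  qed
  show ?thesis
  proof (rule ex1I[of _ c])
    fix c' assume c': "c' \<in> carrier_vec d \<and>
      (\<forall>x\<in>carrier_vec d. c' \<bullet> x = det (mat_of_cols d (xs @ [x])))"
    have "c' \<bullet> unit_vec d i = c \<bullet> unit_vec d i" for i
      using c' eq by simp
    then have "c' $ i = c $ i" if "i < d" for i
      using that c c' by (metis scalar_prod_right_unit)
    then show "c' = c" using c c' by (intro eq_vecI) auto
  qed (use c eq in blast)
qed

definition diagonals :: "nat \<Rightarrow> real vec set \<Rightarrow> real vec set set" where
  "diagonals d W = {D. D \<subseteq> W \<and> card D = d - 1}"

definition exponents :: "nat \<Rightarrow> nat \<Rightarrow> nat list set" where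
  "exponents d k = {e. length e = d \<and> sum_list e = k}"

lemma card_exponents: "d \<ge> 1 \<Longrightarrow> card (exponents d k) = (d + k - 1) choose (d - 1)"
  using binomial_symmetric[of "d - 1" "k + d - 1"]
  by (simp add: exponents_def card_length_sum_list add.commute)

definition monomial :: "real vec \<Rightarrow> nat list \<Rightarrow> real" where
  "monomial x e = (\<Prod>i<length e. (x $ i) ^ (e ! i))"

text \<open>The list \<open>es\<close> enumerates the exponents of the monomials of degree \<open>k\<close> in a fixed order,
  so \<open>veronese es\<close> is \<open>\<nu>\<^sub>k\<close> when \<^term>\<open>set es = exponents d k\<close> and \<^term>\<open>distinct es\<close>.\<close>

definition veronese :: "nat list list \<Rightarrow> real vec \<Rightarrow> real vec" where
  "veronese es x = vec_of_list (map (monomial x) es)"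

text \<open>The list \<open>Ds\<close> enumerates the diagonals, and \<open>\<sigma> D\<close> lists the elements of the
  diagonal \<open>D\<close> in the order in which they enter the cross product \<open>D\<^sup>*\<close>.\<close>

definition diagonal_matrix ::
  "nat \<Rightarrow> nat list list \<Rightarrow> (real vec set \<Rightarrow> real vec list) \<Rightarrow> real vec set list \<Rightarrow> real mat" where
  "diagonal_matrix d es \<sigma> Ds =
    mat_of_rows (length es) (map (\<lambda>D. veronese es (cross_product d (\<sigma> D))) Ds)"

definition has_full_rank :: "real mat \<Rightarrow> bool" where
  "has_full_rank A \<longleftrightarrow> vec_space.rank (dim_row A) A = min (dim_row A) (dim_col A)"

end

theory Submission
  imports Defs "Jordan_Normal_Form.DL_Rank_Submatrix"
begin

text \<open>Fix a generator \<open>a\<close>. The diagonals avoiding \<open>a\<close> are as many as the columns of the matrix.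
  For each such diagonal \<open>D\<close> the product of the linear forms \<open>\<langle>w, x\<rangle>\<close> over the generators
  \<open>w \<noteq> a\<close> outside \<open>D\<close> is homogeneous of degree \<open>n - d\<close>. By general position it is nonzero at
  \<open>D\<^sup>*\<close>, and it vanishes at \<open>E\<^sup>*\<close> for every other diagonal \<open>E\<close> avoiding \<open>a\<close>, as \<open>E\<close> contains one of
  these \<open>w\<close>. Hence the square submatrix of the rows avoiding \<open>a\<close> times the matrix of the
  coefficients of these products is an invertible diagonal matrix.\<close>

text \<open>Polynomials are kept as functions. Only the coefficient family \<open>c\<close> matters,
  since it later becomes a column to be multiplied with the Veronese rows.\<close>

definition homogeneous_form :: "nat \<Rightarrow> nat \<Rightarrow> (real vec \<Rightarrow> real) \<Rightarrow> bool" where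
  "homogeneous_form d k f \<longleftrightarrow>
    (\<exists>c. \<forall>x\<in>carrier_vec d. f x = (\<Sum>e\<in>exponents d k. c e * monomial x e))"

lemma finite_exponents: "finite (exponents d k)"
proof (rule finite_subset)
  show "exponents d k \<subseteq> {e. set e \<subseteq> {..k} \<and> length e = d}"
    by (auto simp: exponents_def intro: member_le_sum_list)
qed (rule finite_lists_length_eq, simp)

lemma homogeneous_form_cong:
  assumes "homogeneous_form d k f" and "\<And>x. x \<in> carrier_vec d \<Longrightarrow> g x = f x"
  shows "homogeneous_form d k g"
  using assms by (simp add: homogeneous_form_def)

lemma homogeneous_form_sum:
  assumes "\<And>i. i \<in> I \<Longrightarrow> homogeneous_form d k (f i)"
  shows "homogeneous_form d k (\<lambda>x. \<Sum>i\<in>I. b i * f i x)"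
proof -
  obtain c where c: "\<And>i x. i \<in> I \<Longrightarrow> x \<in> carrier_vec d \<Longrightarrow>
      f i x = (\<Sum>e\<in>exponents d k. c i e * monomial x e)"
    using assms unfolding homogeneous_form_def by metis
  have "(\<Sum>i\<in>I. b i * f i x) = (\<Sum>e\<in>exponents d k. (\<Sum>i\<in>I. b i * c i e) * monomial x e)"
    if "x \<in> carrier_vec d" for x
  proof -
    have "(\<Sum>i\<in>I. b i * f i x) = (\<Sum>i\<in>I. \<Sum>e\<in>exponents d k. b i * c i e * monomial x e)"
      using c that by (simp add: sum_distrib_left mult.assoc)
    also have "\<dots> = (\<Sum>e\<in>exponents d k. \<Sum>i\<in>I. b i * c i e * monomial x e)"
      by (rule sum.swap)
    finally show ?thesis by (simp add: sum_distrib_right)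
  qed
  then show ?thesis
    unfolding homogeneous_form_def
    by (intro exI[of _ "\<lambda>e. \<Sum>i\<in>I. b i * c i e"]) simp
qed

lemma homogeneous_form_monomial:
  assumes "e \<in> exponents d k"
  shows "homogeneous_form d k (\<lambda>x. monomial x e)"
  unfolding homogeneous_form_def
  by (rule exI[of _ "\<lambda>e'. if e' = e then 1 else 0"])
    (use assms in \<open>simp add: finite_exponents if_distrib[of "\<lambda>r. r * _"] cong: if_cong\<close>)

lemma monomial_increment:
  assumes "i < length e"
  shows "monomial x (e[i := Suc (e ! i)]) = x $ i * monomial x e"
proof -
  \<comment> \<open>Splitting off the factor at \<open>i\<close> for any list of this length lets
    both \<open>e\<close> and its update be compared: the remaining product is the same for
    both.\<close>
  have "monomial x e' = x $ i ^ (e' ! i) * (\<Prod>j\<in>{..<length e} - {i}. x $ j ^ (e' ! j))"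
    if "length e' = length e" for e'
    using assms that by (simp add: monomial_def prod.remove)
  from this[of e] this[of "e[i := Suc (e ! i)]"] show ?thesis
    using assms by simp
qed

text \<open>Expanding the inner product over coordinates raises one exponent at a time. Several
  pairs of \<open>i\<close> and \<open>e\<close> may yield the same monomial; closure under linear
  combinations spares collecting the coefficients.\<close>

lemma homogeneous_form_linear_mult:
  assumes f: "homogeneous_form d k f" and w: "w \<in> carrier_vec d"
  shows "homogeneous_form d (Suc k) (\<lambda>x. (x \<bullet> w) * f x)"
proof -
  obtain c where c: "\<And>x. x \<in> carrier_vec d \<Longrightarrow> f x = (\<Sum>e\<in>exponents d k. c e * monomial x e)"
    using f unfolding homogeneous_form_def by blast
  have incr: "e[i := Suc (e ! i)] \<in> exponents d (Suc k)" if "e \<in> exponents d k" "i < d" for e i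
    using that by (simp add: exponents_def sum_list_update member_le_sum_list Suc_diff_le)
  have "homogeneous_form d (Suc k)
      (\<lambda>x. \<Sum>i<d. w $ i * (\<Sum>e\<in>exponents d k. c e * monomial x (e[i := Suc (e ! i)])))"
    by (intro homogeneous_form_sum homogeneous_form_monomial incr) simp_all
  then show ?thesis
  proof (rule homogeneous_form_cong)
    fix x :: "real vec"
    assume x: "x \<in> carrier_vec d"
    have "(x \<bullet> w) * f x = (\<Sum>i<d. w $ i * (\<Sum>e\<in>exponents d k. c e * (x $ i * monomial x e)))"
      using w x by (simp add: c scalar_prod_def lessThan_atLeast0 sum_distrib_left
          sum_distrib_right algebra_simps)
    also have "\<dots> = (\<Sum>i<d. w $ i * (\<Sum>e\<in>exponents d k. c e * monomial x (e[i := Suc (e ! i)])))"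
      by (intro sum.cong refl arg_cong2[where f = "(*)"])
        (simp add: exponents_def monomial_increment)
    finally show "(x \<bullet> w) * f x =
      (\<Sum>i<d. w $ i * (\<Sum>e\<in>exponents d k. c e * monomial x (e[i := Suc (e ! i)])))" .
  qed
qed

lemma homogeneous_form_prod_linear:
  assumes "finite S" and "S \<subseteq> carrier_vec d"
  shows "homogeneous_form d (card S) (\<lambda>x. \<Prod>w\<in>S. x \<bullet> w)"
  using assms
proof (induction S)
  case empty
  \<comment> \<open>The empty product is the constant 1, the monomial whose exponents are all
    zero.\<close>
  have "replicate d 0 \<in> exponents d 0" by (simp add: exponents_def)
  from homogeneous_form_monomial[OF this] show ?case by (simp add: monomial_def)
next
  case (insert w S)
  then show ?case using homogeneous_form_linear_mult[of d "card S" _ w] by simp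
qed

lemma (in vec_space) full_rank_if_diagonal_product:
  assumes A: "A \<in> carrier_mat n N"
    and I: "I \<subseteq> {..<n}" "card I = N"
    and diag: "\<And>i. i \<in> I \<Longrightarrow> (\<Sum>k<N. A $$ (i, k) * c i k) \<noteq> 0"
    and off: "\<And>i j. i \<in> I \<Longrightarrow> j \<in> I \<Longrightarrow> i \<noteq> j \<Longrightarrow> (\<Sum>k<N. A $$ (i, k) * c j k) = 0"
  shows "rank A = N"
proof -
  have cardI: "card {i. i < dim_row A \<and> i \<in> I} = N"
    using A I by (metis (no_types, lifting) Collect_cong Collect_mem_eq carrier_matD(1)
        lessThan_iff subsetD)
  have fin: "finite I" using I(1) finite_subset by blast
  define B where "B = submatrix A I UNIV"
  \<comment> \<open>\<open>pick I j\<close> is the j-th smallest element of \<open>I\<close>, so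
    column \<open>j\<close> of \<open>C\<close> belongs to the same row of \<open>A\<close> as row
    \<open>j\<close> of \<open>B\<close>.\<close>
  define C where "C = mat N N (\<lambda>(k, j). c (pick I j) k)"
  have B: "B \<in> carrier_mat N N"
    using A cardI by (auto simp: B_def dim_submatrix)
  have C: "C \<in> carrier_mat N N" by (simp add: C_def)
  have pick: "pick I i \<in> I" if "i < N" for i
    using that I(2) by (auto intro: pick_in_set)
  have pick_inj: "pick I i \<noteq> pick I j" if "i < N" "j < N" "i \<noteq> j" for i j
    using that pick_mono[of j I i] pick_mono[of i I j] I(2) by (cases "i < j") auto
  have Bent: "B $$ (i, k) = A $$ (pick I i, k)" if "i < N" "k < N" for i k
    using that A cardI by (simp add: B_def submatrix_index pick_UNIV)
  have BC: "(B * C) $$ (i, j) = (\<Sum>k<N. A $$ (pick I i, k) * c (pick I j) k)"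
    if "i < N" "j < N" for i j
    using B C that by (simp add: scalar_prod_def Bent C_def lessThan_atLeast0)
  \<comment> \<open>By \<open>diag\<close> and \<open>off\<close> the product is diagonal with
    nonzero diagonal entries; being upper triangular, it has the product of these entries as
    determinant.\<close>
  have "det (B * C) = prod_list (diag_mat (B * C))"
    using B C by (intro det_upper_triangular[of _ N] upper_triangularI)
      (auto simp: BC off pick pick_inj simp del: index_mult_mat(1))
  also have "\<dots> \<noteq> 0"
    using B C by (auto simp: diag_mat_def prod_list_zero_iff BC diag pick
        simp del: index_mult_mat(1))
  finally have "det B \<noteq> 0" using det_mult[OF B C] by auto
  then have "N \<le> rank A"
    using rank_gt_minor[OF A, of I UNIV] by (simp add: B_def)
  then show ?thesis using rank_le_nc[OF A] by simp
qed

lemma cross_product_scalar_prod: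
  assumes "d \<ge> 1" and "length xs = d - 1"
  shows "cross_product d xs \<in> carrier_vec d"
    and "x \<in> carrier_vec d \<Longrightarrow> cross_product d xs \<bullet> x = det (mat_of_cols d (xs @ [x]))"
  using theI'[OF cross_product_unique_exists[OF assms]] by (auto simp: cross_product_def)

text \<open>The inner product is a determinant in which \<open>x\<close> occurs twice as a column,
  once among \<open>xs\<close> and once in the last place.\<close>

lemma cross_product_orthogonal:
  assumes d: "d \<ge> 1" "length xs = d - 1" and x: "x \<in> set xs" "x \<in> carrier_vec d"
  shows "cross_product d xs \<bullet> x = 0"
proof -
  obtain i where i: "i < length xs" "xs ! i = x"
    using x by (auto simp: in_set_conv_nth)
  have "det (mat_of_cols d (xs @ [x])) = 0"
  proof (rule det_identical_columns)
    show "mat_of_cols d (xs @ [x]) \<in> carrier_mat d d"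
      using d by (simp add: mat_of_cols_def)
    show "col (mat_of_cols d (xs @ [x])) i = col (mat_of_cols d (xs @ [x])) (d - 1)"
      using d i x by (simp add: col_mat_of_cols nth_append)
  qed (use d i in auto)
  then show ?thesis using cross_product_scalar_prod(2)[OF d x(2)] by simp
qed

text \<open>The inner product is the determinant of \<open>d\<close> distinct vectors of
  \<open>W\<close>, which general position makes independent.\<close>

lemma cross_product_nonzero:
  assumes gp: "general_position d W" and W: "W \<subseteq> carrier_vec d"
    and d: "d \<ge> 1" "length xs = d - 1" and xs: "distinct xs" "set xs \<subseteq> W"
    and x: "x \<in> W" "x \<notin> set xs"
  shows "cross_product d xs \<bullet> x \<noteq> 0"
proof -
  interpret vec_space "TYPE(real)" d .
  let ?A = "mat_of_cols d (xs @ [x])"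
  have A: "?A \<in> carrier_mat d d" using d by (simp add: mat_of_cols_def)
  have cols: "cols ?A = xs @ [x]"
    using W xs x by (intro cols_mat_of_cols) auto
  have dist: "distinct (xs @ [x])" using xs x by simp
  have "set (xs @ [x]) \<subseteq> W" "card (set (xs @ [x])) = d"
    using xs x d distinct_card[OF dist] by auto
  then have "lin_indpt (set (cols ?A))"
    using gp unfolding general_position_def cols by blast
  then have "rank ?A = d"
    using lin_indpt_full_rank[OF A] dist cols by simp
  then have "det ?A \<noteq> 0" using det_rank_iff[OF A] by simp
  then show ?thesis using cross_product_scalar_prod(2)[OF d] W x by auto
qed

text \<open>Pairing a row of the matrix with a coefficient column evaluates the corresponding
  polynomial at the point of that row.\<close>

lemma veronese_scalar_prod:
  assumes "distinct es"
  shows "(\<Sum>k<length es. veronese es x $ k * c (es ! k)) = (\<Sum>e\<in>set es. c e * monomial x e)"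
proof -
  have "(\<Sum>k<length es. veronese es x $ k * c (es ! k))
      = (\<Sum>k<length es. c (es ! k) * monomial x (es ! k))"
    by (intro sum.cong) (simp_all add: veronese_def vec_of_list_index)
  also have "\<dots> = sum_list (map (\<lambda>e. c e * monomial x e) es)"
    by (simp add: sum_list_sum_nth lessThan_atLeast0)
  finally show ?thesis using assms by (simp add: sum_list_distinct_conv_sum_set)
qed

theorem theorem2:
  fixes d n :: nat
    and v :: "real vec"
    and W K :: "real vec set"
    and es :: "nat list list"
    and Ds :: "real vec set list"
    and \<sigma> :: "real vec set \<Rightarrow> real vec list"
  assumes "d \<ge> 1"
    and "n \<ge> d"
    and "v \<in> carrier_vec d"
    and "W \<subseteq> carrier_vec d"
    and "finite W"
    and "card W = n"
    and "K = cone d v W"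
    and "strictly_convex d K"
    and "general_position d W"
    and "distinct es"
    and "set es = exponents d (n - d)"
    and "distinct Ds"
    and "set Ds = diagonals d W"
    and "\<And>D. D \<in> diagonals d W \<Longrightarrow> distinct (\<sigma> D) \<and> set (\<sigma> D) = D"
  shows "diagonal_matrix d es \<sigma> Ds
           \<in> carrier_mat (n choose (d - 1)) ((n - 1) choose (d - 1)) \<and>
         has_full_rank (diagonal_matrix d es \<sigma> Ds)"
proof -
  note d = assms(1) and W = assms(4) and fin = assms(5) and cW = assms(6)
  let ?m = "n choose (d - 1)" and ?N = "(n - 1) choose (d - 1)"
  define A where "A = diagonal_matrix d es \<sigma> Ds"
  \<comment> \<open>Here d + (n - d) - 1 = n - 1, where n \<ge> d keeps the truncated subtraction
    exact.\<close>
  have les: "length es = ?N"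
    using distinct_card[OF assms(10)] card_exponents[OF d, of "n - d"] assms(2,11) by simp
  have lDs: "length Ds = ?m"
    using distinct_card[OF assms(12)] n_subsets[OF fin, of "d - 1"] assms(13) cW
    by (simp add: diagonals_def)
  have A: "A \<in> carrier_mat ?m ?N"
    by (simp add: A_def diagonal_matrix_def les lDs mat_of_rows_def)
  have "W \<noteq> {}" using d assms(2) cW by auto
  then obtain a where a: "a \<in> W" by blast
  define I where "I = {i. i < ?m \<and> a \<notin> Ds ! i}"
  have D: "Ds ! i \<in> diagonals d W" if "i < ?m" for i
    using that assms(13) lDs by (metis nth_mem)
  \<comment> \<open>The rows in \<open>I\<close> are counted through the (d - 1)-subsets of the n -
    1 generators other than \<open>a\<close>.\<close>
  have bij: "bij_betw ((!) Ds) I {D. D \<subseteq> W - {a} \<and> card D = d - 1}"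
  proof (rule bij_betw_imageI)
    show "inj_on ((!) Ds) I"
      using inj_on_nth[OF assms(12), of I] lDs by (simp add: I_def)
    show "(!) Ds ` I = {D. D \<subseteq> W - {a} \<and> card D = d - 1}"
    proof
      show "(!) Ds ` I \<subseteq> {D. D \<subseteq> W - {a} \<and> card D = d - 1}"
        using D by (auto simp: I_def diagonals_def)
      show "{D. D \<subseteq> W - {a} \<and> card D = d - 1} \<subseteq> (!) Ds ` I"
      proof
        fix D assume E: "D \<in> {D. D \<subseteq> W - {a} \<and> card D = d - 1}"
        then have "D \<in> set Ds" by (auto simp: assms(13) diagonals_def)
        then obtain i where "i < ?m" "Ds ! i = D" by (auto simp: in_set_conv_nth lDs)
        then show "D \<in> (!) Ds ` I" using E by (auto simp: I_def)
      qed
    qed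
  qed
  have cI: "card I = ?N"
    using bij_betw_same_card[OF bij] n_subsets[of "W - {a}" "d - 1"] fin a cW by simp
  \<comment> \<open>\<open>S i\<close> collects the linear factors of the form attached to row
    \<open>i\<close>, and \<open>p i\<close> is the point at which row \<open>i\<close>
    evaluates.\<close>
  define S where "S i = W - {a} - Ds ! i" for i
  define p where "p i = cross_product d (\<sigma> (Ds ! i))" for i
  have \<sigma>: "length (\<sigma> (Ds ! i)) = d - 1" "distinct (\<sigma> (Ds ! i))" "set (\<sigma> (Ds ! i)) = Ds ! i"
    if "i < ?m" for i
    using assms(14)[OF D[OF that]] D[OF that] distinct_card[of "\<sigma> (Ds ! i)"]
    by (auto simp: diagonals_def)
  have p: "p i \<in> carrier_vec d" if "i < ?m" for i
    using cross_product_scalar_prod(1)[OF d \<sigma>(1)[OF that]] by (simp add: p_def)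
  have I_D: "Ds ! i \<subseteq> W - {a}" "card (Ds ! i) = d - 1" "i < ?m" if "i \<in> I" for i
    using bij that by (auto simp: bij_betw_def I_def)
  have form: "homogeneous_form d (n - d) (\<lambda>x. \<Prod>w\<in>S i. x \<bullet> w)" if i: "i \<in> I" for i
  proof -
    have "finite (Ds ! i)" using I_D(1)[OF i] fin finite_subset by blast
    then have "card (S i) = n - 1 - (d - 1)"
      unfolding S_def using I_D[OF i] a fin cW by (simp add: card_Diff_subset)
    then have "card (S i) = n - d" using d by simp
    moreover have "finite (S i)" "S i \<subseteq> carrier_vec d" using fin W by (auto simp: S_def)
    ultimately show ?thesis using homogeneous_form_prod_linear by metis
  qed
  then obtain c where c: "\<And>i x. i \<in> I \<Longrightarrow> x \<in> carrier_vec d \<Longrightarrow>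
      (\<Prod>w\<in>S i. x \<bullet> w) = (\<Sum>e\<in>exponents d (n - d). c i e * monomial x e)"
    unfolding homogeneous_form_def by metis
  have entries: "(\<Sum>k<?N. A $$ (i, k) * c j (es ! k)) = (\<Prod>w\<in>S j. p i \<bullet> w)"
    if "i \<in> I" "j \<in> I" for i j
  proof -
    have "(\<Sum>k<?N. A $$ (i, k) * c j (es ! k))
        = (\<Sum>k<length es. veronese es (p i) $ k * c j (es ! k))"
      using I_D(3)[OF that(1)]
      by (intro sum.cong) (simp_all add: les lDs A_def diagonal_matrix_def p_def mat_of_rows_index)
    also have "\<dots> = (\<Prod>w\<in>S j. p i \<bullet> w)"
      using c[OF that(2) p] I_D(3)[OF that(1)]
      by (simp add: veronese_scalar_prod[OF assms(10)] assms(11))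
    finally show ?thesis .
  qed
  have "vec_space.rank ?m A = ?N"
  proof (rule vec_space.full_rank_if_diagonal_product[OF A _ cI])
    show "I \<subseteq> {..<?m}" by (auto simp: I_def)
    fix i assume i: "i \<in> I"
    \<comment> \<open>A factor \<open>w\<close> lies outside \<open>Ds ! i\<close>, so together they
      are \<open>d\<close> distinct generators in general position.\<close>
    have "p i \<bullet> w \<noteq> 0" if "w \<in> S i" for w
      unfolding p_def using \<sigma>[OF I_D(3)[OF i]] I_D(1)[OF i] that
      by (intro cross_product_nonzero[OF assms(9) W d]) (auto simp: S_def)
    then show "(\<Sum>k<?N. A $$ (i, k) * c i (es ! k)) \<noteq> 0"
      using fin unfolding entries[OF i i] by (simp add: S_def)
  next
    fix i j assume ij: "i \<in> I" "j \<in> I" "i \<noteq> j"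
    have "Ds ! i \<noteq> Ds ! j" using bij ij by (auto simp: bij_betw_def inj_on_def)
    moreover have "finite (Ds ! j)" using I_D(1)[OF ij(2)] fin finite_subset by blast
    \<comment> \<open>Distinct sets of equal size are not nested. A generator in
      \<open>Ds ! i\<close> but not in \<open>Ds ! j\<close> differs from \<open>a\<close>, hence is
      a factor of form \<open>j\<close>, and it is orthogonal to \<open>p i\<close>.\<close>
    ultimately have "\<not> Ds ! i \<subseteq> Ds ! j"
      using I_D(2)[OF ij(1)] I_D(2)[OF ij(2)] card_subset_eq by metis
    then obtain w where w: "w \<in> Ds ! i" "w \<in> S j"
      using I_D(1)[OF ij(1)] by (auto simp: S_def)
    then have "p i \<bullet> w = 0"
      unfolding p_def using \<sigma>[OF I_D(3)[OF ij(1)]] W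
      by (intro cross_product_orthogonal[OF d]) (auto simp: S_def)
    then show "(\<Sum>k<?N. A $$ (i, k) * c j (es ! k)) = 0"
      using fin w(2) unfolding entries[OF ij(1,2)] by (intro prod_zero) (auto simp: S_def)
  qed
  \<comment> \<open>This makes the number of columns the minimum in
    \<open>has_full_rank\<close>.\<close>
  moreover have "?N \<le> ?m" by (rule binomial_right_mono) simp
  ultimately have "has_full_rank A" using A by (auto simp: has_full_rank_def)
  with A show ?thesis by (simp add: A_def)
qed

end
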